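(* Let $F$ be a tract with a fixed involution, let $E=\{1,\dots,n\}$, and let $0\le r_1\le\dots\le r_s\le n$ be integers. The association $(M_1,\dots,M_s)\mapsto(M_s^*,\dots,M_1^* )$ is a bijection between the set of flag $F$-matroids on $E$ of rank $(r_1,\dots,r_s)$ and the set of flag $F$-matroids on $E$ of rank $(n-r_s,\dots,n-r_1)$.
   Context: A tract is a commutative multiplicative monoid $F$ with identity $1$ and absorbing element $0$ such that $F^\times=F\setminus\{0\}$ is a group, together with a subset $N_F\subseteq\mathbb{N}[F^\times]$ (the nullset) such that $0\in N_F$, $1\notin N_F$, there is a unique $\epsilon\in F^\times$ with $1+\epsilon\in N_F$, and $N_F$ is stable under multiplication by $F^\times$. An involution is a tract morphism $\tau:F\to F$ with $\tau^2=\mathrm{id}$; write $\overline x=\tau(x)$. A Grassmann–Plücker function of rank $r$ on $E$ is a map $\varphi:E^r\to F$, not identically zero, alternating (swapping two arguments multiplies the value by $\epsilon$; value $0$ if two arguments coincide), with $\sum_{k=1}^{r+1}\epsilon^k\varphi(y_1,\dots,\widehat{y_k},\dots,y_{r+1})\varphi(y_k,x_1,\dots,x_{r-1})\in N_F$ for all $x_i,y_j\in E$. An $F$-matroid of rank $r$ is a class $[\varphi]$ modulo multiplication by $F^\times$. Its dual $M^*$ is represented by $\varphi^*(x_1,\dots,x_{n-r})=\mathrm{sign}(x_1,\dots,x_{n-r},x'_1,\dots,x'_r)\,\overline{\varphi(x'_1,\dots,x'_r)}$ whenever $E=\{x_1,\dots,x_{n-r},x'_1,\dots,x'_r\}$ (and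 $0$ otherwise), $\mathrm{sign}$ being the sign of the sorting permutation with $-1$ read as $\epsilon$. If $M=[\mu]$, $N=[\nu]$ have ranks $r,w$, then $N\twoheadrightarrow M$ means $\sum_{k=1}^{w+1}\epsilon^k\nu(y_1,\dots,\widehat{y_k},\dots,y_{w+1})\mu(y_k,x_1,\dots,x_{r-1})\in N_F$ for all $y_1,\dots,y_{w+1},x_1,\dots,x_{r-1}\in E$. A flag $F$-matroid is a sequence $(M_1,\dots,M_s)$ of $F$-matroids on $E$ with $M_j\twoheadrightarrow M_i$ for all $1\le i<j\le s$; its rank is $(\mathrm{rk}M_1,\dots,\mathrm{rk}M_s)$. *)

theory Defs
  imports "HOL-Algebra.Group" "HOL-Combinatorics.Permutations"
begin

text \<open>
  An element of \<open>\<nat>[F\<^sup>\<times>]\<close>, i.e. a finite formal sum of nonzero elements of \<open>F\<close>, is a finite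
  multiset over \<open>F\<^sup>\<times>\<close>: the sum \<open>0\<close> is \<open>{#}\<close> and the sum \<open>a + b\<close> is \<open>{#a, b#}\<close>.
\<close>

record 'a tract = "'a monoid" +
  tzero :: 'a
  nullset :: "'a multiset set"

definition tract_units :: "('a, 'b) tract_scheme \<Rightarrow> 'a set" where
  "tract_units F = carrier F - {tzero F}"

locale tract = comm_monoid F for F :: "('a, 'b) tract_scheme" (structure) +
  assumes tzero_closed: "tzero F \<in> carrier F"
    and tzero_absorb: "x \<in> carrier F \<Longrightarrow> tzero F \<otimes> x = tzero F"
    and units_group: "group (F\<lparr>carrier := tract_units F\<rparr>)"
    and nullset_subset: "A \<in> nullset F \<Longrightarrow> set_mset A \<subseteq> tract_units F"
    and zero_in_nullset: "{#} \<in> nullset F"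
    and one_notin_nullset: "{#\<one>#} \<notin> nullset F"
    and ex1_eps: "\<exists>!e. e \<in> tract_units F \<and> {#\<one>, e#} \<in> nullset F"
    and nullset_stable:
      "c \<in> tract_units F \<Longrightarrow> A \<in> nullset F \<Longrightarrow> image_mset (\<lambda>a. c \<otimes> a) A \<in> nullset F"

definition tract_eps :: "('a, 'b) tract_scheme \<Rightarrow> 'a" where
  "tract_eps F = (THE e. e \<in> tract_units F \<and> {#\<one>\<^bsub>F\<^esub>, e#} \<in> nullset F)"

definition tract_morphism ::
    "('a, 'b) tract_scheme \<Rightarrow> ('c, 'd) tract_scheme \<Rightarrow> ('a \<Rightarrow> 'c) \<Rightarrow> bool" where
  "tract_morphism F G f \<longleftrightarrow>
     f \<in> hom F G \<and> f \<one>\<^bsub>F\<^esub> = \<one>\<^bsub>G\<^esub> \<and> f (tzero F) = tzero G \<and>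
     (\<forall>A\<in>nullset F. image_mset f A \<in> nullset G)"

definition tract_involution :: "('a, 'b) tract_scheme \<Rightarrow> ('a \<Rightarrow> 'a) \<Rightarrow> bool" where
  "tract_involution F \<tau> \<longleftrightarrow> tract_morphism F F \<tau> \<and> (\<forall>x\<in>carrier F. \<tau> (\<tau> x) = x)"

text \<open>
  The canonical map \<open>F \<rightarrow> \<nat>[F\<^sup>\<times>]\<close>; sums of elements of \<open>F\<close> in \<open>\<nat>[F\<^sup>\<times>]\<close> are taken through it,
  so that zero terms are dropped.
\<close>

definition formal :: "('a, 'b) tract_scheme \<Rightarrow> 'a \<Rightarrow> 'a multiset" where
  "formal F a = (if a = tzero F then {#} else {#a#})"

text \<open>\<open>tuples n r\<close> is \<open>E\<^sup>r\<close> for \<open>E = {1..n}\<close>.\<close>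

definition tuples :: "nat \<Rightarrow> nat \<Rightarrow> nat list set" where
  "tuples n r = {xs. length xs = r \<and> set xs \<subseteq> {1..n}}"

text \<open>
  The relations between \<open>\<nu> : E\<^sup>w \<rightarrow> F\<close> and \<open>\<mu> : E\<^sup>r \<rightarrow> F\<close>. List positions start at 0, hence
  the exponent \<open>Suc k\<close>. For \<open>r = 0\<close> there are no tuples \<open>(x\<^sub>1, \<dots>, x\<^sub>r\<^sub>-\<^sub>1)\<close> and the condition is
  empty; the premise \<open>1 \<le> r\<close> is needed because natural subtraction truncates.
\<close>

definition pluecker_rel ::
    "('a, 'b) tract_scheme \<Rightarrow> nat \<Rightarrow> nat \<Rightarrow> (nat list \<Rightarrow> 'a) \<Rightarrow> nat \<Rightarrow> (nat list \<Rightarrow> 'a) \<Rightarrow> bool"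
  where
  "pluecker_rel F n w \<nu> r \<mu> \<longleftrightarrow>
     (1 \<le> r \<longrightarrow>
       (\<forall>ys\<in>tuples n (w + 1). \<forall>xs\<in>tuples n (r - 1).
         (\<Sum>k<w + 1. formal F
            (tract_eps F [^]\<^bsub>F\<^esub> Suc k \<otimes>\<^bsub>F\<^esub>
              (\<nu> (take k ys @ drop (Suc k) ys) \<otimes>\<^bsub>F\<^esub> \<mu> (ys ! k # xs)))) \<in> nullset F))"

definition alternating :: "('a, 'b) tract_scheme \<Rightarrow> nat \<Rightarrow> nat \<Rightarrow> (nat list \<Rightarrow> 'a) \<Rightarrow> bool" where
  "alternating F n r \<phi> \<longleftrightarrow>
     (\<forall>xs\<in>tuples n r.
        (\<forall>i j. i < j \<and> j < r \<longrightarrow>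
            \<phi> (xs[i := xs ! j, j := xs ! i]) = tract_eps F \<otimes>\<^bsub>F\<^esub> \<phi> xs) \<and>
        (\<not> distinct xs \<longrightarrow> \<phi> xs = tzero F))"

text \<open>
  A map \<open>E\<^sup>r \<rightarrow> F\<close> is represented by its extension by zero to all lists. A value in
  \<open>F\<close> outside the domain other than \<open>tzero F\<close> (such as \<open>undefined\<close>) would allow the
  same function to represent maps with different \<open>r\<close>; nonzero maps extended by zero determine \<open>r\<close>.
\<close>

definition gp_function :: "('a, 'b) tract_scheme \<Rightarrow> nat \<Rightarrow> nat \<Rightarrow> (nat list \<Rightarrow> 'a) \<Rightarrow> bool" where
  "gp_function F n r \<phi> \<longleftrightarrow>
     (\<forall>xs\<in>tuples n r. \<phi> xs \<in> carrier F) \<and>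
     (\<forall>xs. xs \<notin> tuples n r \<longrightarrow> \<phi> xs = tzero F) \<and>
     (\<exists>xs\<in>tuples n r. \<phi> xs \<noteq> tzero F) \<and>
     alternating F n r \<phi> \<and>
     pluecker_rel F n r \<phi> r \<phi>"

definition gp_class :: "('a, 'b) tract_scheme \<Rightarrow> (nat list \<Rightarrow> 'a) \<Rightarrow> (nat list \<Rightarrow> 'a) set" where
  "gp_class F \<phi> = {\<lambda>xs. c \<otimes>\<^bsub>F\<^esub> \<phi> xs | c. c \<in> tract_units F}"

definition matroid_of_rank ::
    "('a, 'b) tract_scheme \<Rightarrow> nat \<Rightarrow> nat \<Rightarrow> (nat list \<Rightarrow> 'a) set \<Rightarrow> bool" where
  "matroid_of_rank F n r M \<longleftrightarrow> (\<exists>\<phi>. gp_function F n r \<phi> \<and> M = gp_class F \<phi>)"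

definition tract_matroid :: "('a, 'b) tract_scheme \<Rightarrow> nat \<Rightarrow> (nat list \<Rightarrow> 'a) set \<Rightarrow> bool" where
  "tract_matroid F n M \<longleftrightarrow> (\<exists>r. matroid_of_rank F n r M)"

definition rk :: "('a, 'b) tract_scheme \<Rightarrow> nat \<Rightarrow> (nat list \<Rightarrow> 'a) set \<Rightarrow> nat" where
  "rk F n M = (THE r. matroid_of_rank F n r M)"

text \<open>
  The sign of an ordering \<open>zs\<close> of \<open>{1..length zs}\<close>, with \<open>-1\<close> read as \<open>\<epsilon>\<close>. The permutation
  \<open>i \<mapsto> zs\<^sub>i\<close> below is the inverse of the one sorting \<open>zs\<close> and has the same sign.
\<close>

definition list_perm :: "nat list \<Rightarrow> nat \<Rightarrow> nat" where
  "list_perm zs i = (if i \<in> {1..length zs} then zs ! (i - 1) else i)"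

definition tract_sign :: "('a, 'b) tract_scheme \<Rightarrow> nat list \<Rightarrow> 'a" where
  "tract_sign F zs = (if evenperm (list_perm zs) then \<one>\<^bsub>F\<^esub> else tract_eps F)"

text \<open>
  The complement of \<open>xs\<close> is listed in increasing order; any other order gives the same value, see
  \<open>dual_fun_eq\<close> below.
\<close>

definition dual_fun ::
    "('a, 'b) tract_scheme \<Rightarrow> ('a \<Rightarrow> 'a) \<Rightarrow> nat \<Rightarrow> nat \<Rightarrow> (nat list \<Rightarrow> 'a) \<Rightarrow> nat list \<Rightarrow> 'a" where
  "dual_fun F \<tau> n r \<phi> xs =
     (if xs \<in> tuples n (n - r) \<and> distinct xs
      then (let ys = sorted_list_of_set ({1..n} - set xs)
            in tract_sign F (xs @ ys) \<otimes>\<^bsub>F\<^esub> \<tau> (\<phi> ys))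
      else tzero F)"

definition dual ::
    "('a, 'b) tract_scheme \<Rightarrow> ('a \<Rightarrow> 'a) \<Rightarrow> nat \<Rightarrow> (nat list \<Rightarrow> 'a) set \<Rightarrow> (nat list \<Rightarrow> 'a) set" where
  "dual F \<tau> n M = (\<Union>\<phi>\<in>M. gp_class F (dual_fun F \<tau> n (rk F n M) \<phi>))"

text \<open>
  \<open>tract_quotient F n N M\<close> is \<open>N \<twoheadrightarrow> M\<close>. The relations do not depend on the representatives, see
  \<open>tract_quotient_iff\<close> below.
\<close>

definition tract_quotient ::
    "('a, 'b) tract_scheme \<Rightarrow> nat \<Rightarrow> (nat list \<Rightarrow> 'a) set \<Rightarrow> (nat list \<Rightarrow> 'a) set \<Rightarrow> bool" where
  "tract_quotient F n N M \<longleftrightarrow>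
     (\<forall>\<nu>\<in>N. \<forall>\<mu>\<in>M. pluecker_rel F n (rk F n N) \<nu> (rk F n M) \<mu>)"

definition flag_matroid :: "('a, 'b) tract_scheme \<Rightarrow> nat \<Rightarrow> (nat list \<Rightarrow> 'a) set list \<Rightarrow> bool" where
  "flag_matroid F n Ms \<longleftrightarrow>
     (\<forall>M\<in>set Ms. tract_matroid F n M) \<and>
     (\<forall>i j. i < j \<and> j < length Ms \<longrightarrow> tract_quotient F n (Ms ! j) (Ms ! i))"

definition flag_matroids_of_rank ::
    "('a, 'b) tract_scheme \<Rightarrow> nat \<Rightarrow> nat list \<Rightarrow> (nat list \<Rightarrow> 'a) set list set" where
  "flag_matroids_of_rank F n rs = {Ms. flag_matroid F n Ms \<and> map (rk F n) Ms = rs}"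


subsection \<open>Well-definedness\<close>

context tract
begin

lemma one_unit: "\<one> \<in> tract_units F"
proof -
  interpret G: group "F\<lparr>carrier := tract_units F\<rparr>" by (rule units_group)
  show ?thesis using G.one_closed by simp
qed

lemma unit_mult: "a \<in> tract_units F \<Longrightarrow> b \<in> tract_units F \<Longrightarrow> a \<otimes> b \<in> tract_units F"
proof -
  interpret G: group "F\<lparr>carrier := tract_units F\<rparr>" by (rule units_group)
  show "a \<in> tract_units F \<Longrightarrow> b \<in> tract_units F \<Longrightarrow> ?thesis" using G.m_closed by simp
qed

lemma unit_inv:
  assumes "a \<in> tract_units F"
  obtains b where "b \<in> tract_units F" "a \<otimes> b = \<one>" "b \<otimes> a = \<one>"
proof -
  interpret G: group "F\<lparr>carrier := tract_units F\<rparr>" by (rule units_group)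
  show ?thesis using G.r_inv[of a] G.l_inv[of a] G.inv_closed[of a] assms that by simp
qed

lemma unit_carrier: "a \<in> tract_units F \<Longrightarrow> a \<in> carrier F"
  by (simp add: tract_units_def)

lemma tzero_absorb': "x \<in> carrier F \<Longrightarrow> x \<otimes> tzero F = tzero F"
  using tzero_absorb[of x] m_comm[OF tzero_closed, of x] by simp

lemma eps_unit: "tract_eps F \<in> tract_units F"
  and eps_null: "{#\<one>, tract_eps F#} \<in> nullset F"
  using theI'[OF ex1_eps] by (auto simp: tract_eps_def)

lemma eps_unique: "e \<in> tract_units F \<Longrightarrow> {#\<one>, e#} \<in> nullset F \<Longrightarrow> e = tract_eps F"
  using ex1_eps eps_unit eps_null by blast

lemma eps_carrier: "tract_eps F \<in> carrier F"
  using eps_unit unit_carrier by blast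

lemma eps_eps: "tract_eps F \<otimes> tract_eps F = \<one>"
proof -
  obtain b where b: "b \<in> tract_units F" "tract_eps F \<otimes> b = \<one>" "b \<otimes> tract_eps F = \<one>"
    using unit_inv[OF eps_unit] .
  have "image_mset (\<lambda>a. b \<otimes> a) {#\<one>, tract_eps F#} \<in> nullset F"
    using nullset_stable[OF b(1) eps_null] .
  then have "{#\<one>, b#} \<in> nullset F"
    using b unit_carrier by (simp add: add_mset_commute)
  then show ?thesis using eps_unique[OF b(1)] b by simp
qed

lemma matroid_of_rank_unique:
  assumes "matroid_of_rank F n r M" "matroid_of_rank F n r' M"
  shows "r = r'"
proof -
  obtain \<phi> \<psi> where 1: "gp_function F n r \<phi>" "M = gp_class F \<phi>"
    and 2: "gp_function F n r' \<psi>" "M = gp_class F \<psi>"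
    using assms by (auto simp: matroid_of_rank_def)
  obtain xs where xs: "xs \<in> tuples n r" "\<phi> xs \<noteq> tzero F" "\<phi> xs \<in> carrier F"
    using 1 by (auto simp: gp_function_def)
  have "(\<lambda>xs. \<one> \<otimes> \<phi> xs) \<in> gp_class F \<psi>"
    using 1 2 one_unit by (auto simp: gp_class_def)
  then obtain c where c: "c \<in> tract_units F" "\<And>xs. \<one> \<otimes> \<phi> xs = c \<otimes> \<psi> xs"
    unfolding gp_class_def by (auto dest: fun_cong)
  have "\<phi> xs = c \<otimes> \<psi> xs" using c(2)[of xs] xs by simp
  then have "\<psi> xs \<noteq> tzero F" using xs(2) c(1) tzero_absorb' unit_carrier by auto
  then have "xs \<in> tuples n r'" using 2(1) by (auto simp: gp_function_def)
  then show ?thesis using xs(1) by (simp add: tuples_def)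
qed

lemma rk_eq: "matroid_of_rank F n r M \<Longrightarrow> rk F n M = r"
  unfolding rk_def using matroid_of_rank_unique by blast

lemma formal_scale:
  assumes "c \<in> tract_units F" "a \<in> carrier F"
  shows "formal F (c \<otimes> a) = image_mset (\<lambda>a. c \<otimes> a) (formal F a)"
proof (cases "a = tzero F")
  case True
  then show ?thesis using assms tzero_absorb' unit_carrier by (simp add: formal_def)
next
  case False
  then have "c \<otimes> a \<in> tract_units F" using assms unit_mult by (simp add: tract_units_def)
  then show ?thesis using False by (simp add: formal_def tract_units_def)
qed

lemma pluecker_rel_scale:
  assumes "c \<in> tract_units F" "d \<in> tract_units F"
    and "\<And>xs. \<nu> xs \<in> carrier F" "\<And>xs. \<mu> xs \<in> carrier F"
    and "pluecker_rel F n w \<nu> r \<mu>"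
  shows "pluecker_rel F n w (\<lambda>xs. c \<otimes> \<nu> xs) r (\<lambda>xs. d \<otimes> \<mu> xs)"
  unfolding pluecker_rel_def
proof (intro impI ballI)
  fix ys xs assume *: "1 \<le> r" "ys \<in> tuples n (w + 1)" "xs \<in> tuples n (r - 1)"
  let ?t = "\<lambda>k. tract_eps F [^] Suc k \<otimes> (\<nu> (take k ys @ drop (Suc k) ys) \<otimes> \<mu> (ys ! k # xs))"
  have cd: "c \<otimes> d \<in> tract_units F" using assms unit_mult by simp
  have "tract_eps F [^] Suc k \<otimes> ((c \<otimes> \<nu> (take k ys @ drop (Suc k) ys)) \<otimes> (d \<otimes> \<mu> (ys ! k # xs)))
      = (c \<otimes> d) \<otimes> ?t k" for k
    using assms(3,4) unit_carrier[OF assms(1)] unit_carrier[OF assms(2)]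
      nat_pow_closed[OF eps_carrier, of "Suc k"]
    by (simp add: m_ac del: nat_pow_Suc)
  then have "(\<Sum>k<w + 1. formal F
       (tract_eps F [^] Suc k \<otimes> ((c \<otimes> \<nu> (take k ys @ drop (Suc k) ys)) \<otimes> (d \<otimes> \<mu> (ys ! k # xs)))))
     = (\<Sum>k<w + 1. image_mset (\<lambda>a. (c \<otimes> d) \<otimes> a) (formal F (?t k)))"
    using assms(3,4) eps_carrier by (simp add: formal_scale[OF cd] del: sum.lessThan_Suc)
  also have "\<dots> = image_mset (\<lambda>a. (c \<otimes> d) \<otimes> a) (\<Sum>k<w + 1. formal F (?t k))"
    by (induction w) auto
  finally show "(\<Sum>k<w + 1. formal F
       (tract_eps F [^] Suc k \<otimes> ((c \<otimes> \<nu> (take k ys @ drop (Suc k) ys)) \<otimes> (d \<otimes> \<mu> (ys ! k # xs)))))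
      \<in> nullset F"
    using nullset_stable[OF cd] assms(5) * by (simp add: pluecker_rel_def del: sum.lessThan_Suc)
qed

lemma gp_function_carrier: "gp_function F n r \<phi> \<Longrightarrow> \<phi> xs \<in> carrier F"
  using tzero_closed by (cases "xs \<in> tuples n r") (auto simp: gp_function_def)

lemma tract_quotient_iff:
  assumes "gp_function F n w \<nu>" "gp_function F n r \<mu>"
  shows "tract_quotient F n (gp_class F \<nu>) (gp_class F \<mu>) \<longleftrightarrow> pluecker_rel F n w \<nu> r \<mu>"
proof -
  have rk: "rk F n (gp_class F \<nu>) = w" "rk F n (gp_class F \<mu>) = r"
    using assms by (auto intro!: rk_eq simp: matroid_of_rank_def)
  have "\<nu> = (\<lambda>xs. \<one> \<otimes> \<nu> xs)" "\<mu> = (\<lambda>xs. \<one> \<otimes> \<mu> xs)"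
    using assms gp_function_carrier by (auto simp: fun_eq_iff)
  then have "\<nu> \<in> gp_class F \<nu>" "\<mu> \<in> gp_class F \<mu>"
    using one_unit unfolding gp_class_def by blast+
  moreover have "pluecker_rel F n w \<nu>' r \<mu>'"
    if "pluecker_rel F n w \<nu> r \<mu>" "\<nu>' \<in> gp_class F \<nu>" "\<mu>' \<in> gp_class F \<mu>" for \<nu>' \<mu>'
    using that pluecker_rel_scale assms gp_function_carrier unfolding gp_class_def by blast
  ultimately show ?thesis unfolding tract_quotient_def rk by blast
qed

lemma involution_eps:
  assumes "tract_involution F \<tau>"
  shows "\<tau> (tract_eps F) = tract_eps F"
proof (rule eps_unique)
  have m: "\<tau> \<in> hom F F" "\<tau> \<one> = \<one>" "\<And>A. A \<in> nullset F \<Longrightarrow> image_mset \<tau> A \<in> nullset F"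
    using assms by (auto simp: tract_involution_def tract_morphism_def)
  show *: "{#\<one>, \<tau> (tract_eps F)#} \<in> nullset F" using m(3)[OF eps_null] m(2) by simp
  show "\<tau> (tract_eps F) \<in> tract_units F" using nullset_subset[OF *] by simp
qed

lemma list_perm_permutes:
  assumes "distinct zs" "set zs = {1..length zs}"
  shows "list_perm zs permutes {1..length zs}"
proof (rule bij_imp_permutes)
  have "bij_betw (\<lambda>i. zs ! i) {..<length zs} {1..length zs}"
    using bij_betw_nth[OF assms(1) refl refl] assms(2) by simp
  moreover have "bij_betw (\<lambda>i. i - 1) {1..length zs} {..<length zs}"
    by (rule bij_betwI[of _ _ _ Suc]) auto
  ultimately have "bij_betw ((\<lambda>i. zs ! i) \<circ> (\<lambda>i. i - 1)) {1..length zs} {1..length zs}"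
    by (rule bij_betw_trans[rotated])
  then show "bij_betw (list_perm zs) {1..length zs} {1..length zs}"
    by (rule bij_betw_cong[THEN iffD1, rotated]) (simp add: list_perm_def)
qed (auto simp: list_perm_def)

lemma tract_sign_swap:
  assumes "distinct zs" "set zs = {1..length zs}" "i < j" "j < length zs"
  shows "tract_sign F (zs[i := zs ! j, j := zs ! i]) = tract_eps F \<otimes> tract_sign F zs"
proof -
  have p: "permutation (list_perm zs)"
    using list_perm_permutes[OF assms(1,2)] permutation_permutes by blast
  have "list_perm (zs[i := zs ! j, j := zs ! i]) = list_perm zs \<circ> Transposition.transpose (Suc i) (Suc j)"
  proof
    fix k
    show "list_perm (zs[i := zs ! j, j := zs ! i]) k
        = (list_perm zs \<circ> Transposition.transpose (Suc i) (Suc j)) k"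
      using assms(3,4)
      by (cases k) (auto simp: list_perm_def Transposition.transpose_def nth_list_update)
  qed
  then have "evenperm (list_perm (zs[i := zs ! j, j := zs ! i])) \<longleftrightarrow> \<not> evenperm (list_perm zs)"
    using assms(3) by (simp add: evenperm_comp[OF p permutation_swap_id] evenperm_swap)
  then show ?thesis using eps_eps eps_carrier by (simp add: tract_sign_def)
qed

lemma permute_list_transpose:
  assumes "i < length ys" "j < length ys"
  shows "permute_list (Transposition.transpose i j) ys = ys[i := ys ! j, j := ys ! i]"
  using assms
  by (intro nth_equalityI) (auto simp: permute_list_def Transposition.transpose_def nth_list_update)

lemma swap_invariant:
  assumes inv: "\<And>i j zs. mset zs = mset ys \<Longrightarrow> i < j \<Longrightarrow> j < length zs \<Longrightarrow>
      g (zs[i := zs ! j, j := zs ! i]) = g zs"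
    and "mset ys' = mset ys"
  shows "g ys' = g ys"
proof -
  obtain p where p: "p permutes {..<length ys}" "permute_list p ys = ys'"
    using mset_eq_permutation[OF assms(2)] .
  have "g (permute_list p ys) = g ys"
    using finite_lessThan p(1)
  proof (induction rule: permutes_rev_induct)
    case (swap a b p)
    let ?zs = "permute_list p ys"
    have "permute_list (p \<circ> Transposition.transpose a b) ys
        = permute_list (Transposition.transpose a b) ?zs"
      using swap.hyps by (intro permute_list_compose permutes_swap_id) auto
    also have "\<dots> = ?zs[a := ?zs ! b, b := ?zs ! a]"
      using swap.hyps by (intro permute_list_transpose) auto
    finally have eq: "permute_list (p \<circ> Transposition.transpose a b) ys
        = ?zs[a := ?zs ! b, b := ?zs ! a]" .
    have m: "mset ?zs = mset ys" using swap.hyps by simp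
    show ?case
    proof (cases "a < b")
      case True
      then show ?thesis unfolding eq using inv[OF m, of a b] swap by simp
    next
      case False
      then have "b < a" using swap by simp
      then show ?thesis unfolding eq using inv[OF m, of b a] swap by (simp add: list_update_swap)
    qed
  qed simp
  then show ?thesis using p by simp
qed

lemma dual_fun_eq:
  assumes \<tau>: "tract_involution F \<tau>" and \<phi>: "gp_function F n r \<phi>"
    and xs: "distinct (xs @ ys)" "set (xs @ ys) = {1..n}" "length ys = r"
  shows "dual_fun F \<tau> n r \<phi> xs = tract_sign F (xs @ ys) \<otimes> \<tau> (\<phi> ys)"
proof -
  let ?g = "\<lambda>ys. tract_sign F (xs @ ys) \<otimes> \<tau> (\<phi> ys)"
  let ?ys = "sorted_list_of_set ({1..n} - set xs)"
  have hom: "\<tau> \<in> hom F F" using \<tau> by (auto simp: tract_involution_def tract_morphism_def)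
  have n: "length xs + r = n" using distinct_card[OF xs(1)] xs(2,3) by simp
  have inv: "?g (zs[i := zs ! j, j := zs ! i]) = ?g zs"
    if zs: "mset zs = mset ys" "i < j" "j < length zs" for i j zs
  proof -
    have l: "length zs = r" and s: "set zs = set ys" and d: "distinct zs"
      using mset_eq_length[OF zs(1)] mset_eq_setD[OF zs(1)] mset_eq_imp_distinct_iff[OF zs(1)] xs
      by simp_all
    have t: "zs \<in> tuples n r" using l s xs by (auto simp: tuples_def)
    have "xs @ zs[i := zs ! j, j := zs ! i]
        = (xs @ zs)[length xs + i := (xs @ zs) ! (length xs + j),
                    length xs + j := (xs @ zs) ! (length xs + i)]"
      by (simp add: list_update_append)
    moreover have "distinct (xs @ zs)" "set (xs @ zs) = {1..length (xs @ zs)}"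
      using s d xs l n by auto
    ultimately have sg: "tract_sign F (xs @ zs[i := zs ! j, j := zs ! i])
        = tract_eps F \<otimes> tract_sign F (xs @ zs)"
      using tract_sign_swap[of "xs @ zs" "length xs + i" "length xs + j"] zs(2,3) by simp
    have "\<phi> (zs[i := zs ! j, j := zs ! i]) = tract_eps F \<otimes> \<phi> zs"
      using \<phi> t zs(2,3) l by (auto simp: gp_function_def alternating_def)
    then have \<phi>s: "\<tau> (\<phi> (zs[i := zs ! j, j := zs ! i])) = tract_eps F \<otimes> \<tau> (\<phi> zs)"
      using hom_mult[OF hom eps_carrier gp_function_carrier[OF \<phi>]] involution_eps[OF \<tau>] by simp
    have c: "tract_sign F (xs @ zs) \<in> carrier F" "\<tau> (\<phi> zs) \<in> carrier F"
      using eps_carrier hom_in_carrier[OF hom gp_function_carrier[OF \<phi>]]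
      by (auto simp: tract_sign_def)
    have "?g (zs[i := zs ! j, j := zs ! i])
        = (tract_eps F \<otimes> tract_eps F) \<otimes> ?g zs"
      unfolding sg \<phi>s using c eps_carrier by (simp add: m_ac)
    then show ?thesis using c eps_eps by simp
  qed
  have "set ?ys = set ys" "distinct ?ys" "distinct ys" using xs by auto
  then have "mset ?ys = mset ys" using set_eq_iff_mset_eq_distinct by blast
  then have "?g ?ys = ?g ys" using swap_invariant[where g = ?g] inv by blast
  moreover have "xs \<in> tuples n (n - r)" "distinct xs" using xs n by (auto simp: tuples_def)
  ultimately show ?thesis unfolding dual_fun_def Let_def by simp
qed

end

end

theory Submission
  imports Defs
begin

text \<open>
  Everything reduces to one computation. Let \<open>ys\<close> and \<open>xs\<close> be injective tuples, let \<open>xs'\<close> list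
  the complement of \<open>ys\<close> and \<open>ys'\<close> that of \<open>xs\<close>. If \<open>y\<^sub>k = y'\<^sub>l\<close>, then moving this
  entry to the appropriate place in \<open>ys @ xs'\<close> and in \<open>xs @ ys'\<close> shows that the \<open>k\<close>-th term of
  the relation between \<open>\<mu>\<^sup>*\<close> and \<open>\<nu>\<^sup>*\<close> at \<open>(ys, xs)\<close> is, up to a unit independent of \<open>k\<close> and \<open>l\<close>,
  the conjugate of the \<open>l\<close>-th term of the relation between \<open>\<nu>\<close> and \<open>\<mu>\<close> at \<open>(ys', xs')\<close>; all terms
  without a partner vanish. If \<open>ys\<close> has a repeated entry, at most two terms survive, and they
  have the form \<open>t\<close> and \<open>\<epsilon> t\<close>. Applied to \<open>\<nu> = \<mu>\<close> this shows that duals are matroids,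
  and in general that duality reverses quotients. Finally \<open>\<phi>\<^sup>*\<^sup>*\<close> is a unit multiple of \<open>\<phi>\<close>, so
  duality is its own inverse on flags.
\<close>

section \<open>Sums over matched positions, and repeated entries in lists\<close>

text \<open>Double counting: both sides are the sum of \<open>g l\<close> over the pairs
  \<open>(k, l)\<close> with \<open>ys ! k = zs ! l\<close>. Distinctness leaves at most one such
  pair in each row and in each column, and positions without a partner contribute zero.\<close>

lemma sum_matching_entries:
  fixes f g :: "nat \<Rightarrow> 'c::comm_monoid_add"
  assumes "distinct ys" "distinct zs"
    and eq: "\<And>k l. k < length ys \<Longrightarrow> l < length zs \<Longrightarrow> ys ! k = zs ! l \<Longrightarrow> f k = g l"
    and f0: "\<And>k. k < length ys \<Longrightarrow> ys ! k \<notin> set zs \<Longrightarrow> f k = 0"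
    and g0: "\<And>l. l < length zs \<Longrightarrow> zs ! l \<notin> set ys \<Longrightarrow> g l = 0"
  shows "(\<Sum>k<length ys. f k) = (\<Sum>l<length zs. g l)"
proof -
  have row: "(\<Sum>l<length zs. if ys ! k = zs ! l then g l else 0) = f k" if k: "k < length ys" for k
  proof (cases "ys ! k \<in> set zs")
    case True
    then obtain m where m: "m < length zs" "ys ! k = zs ! m" by (metis in_set_conv_nth)
    have "(\<Sum>l<length zs. if ys ! k = zs ! l then g l else 0)
        = (\<Sum>l<length zs. if m = l then g l else 0)"
      using m assms(2) by (intro sum.cong) (auto simp: nth_eq_iff_index_eq)
    then show ?thesis using m eq[OF k] by simp
  next
    case False
    then show ?thesis using f0[OF k] by (auto intro!: sum.neutral)
  qed
  have col: "(\<Sum>k<length ys. if ys ! k = zs ! l then g l else 0) = g l" if l: "l < length zs" for l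
  proof (cases "zs ! l \<in> set ys")
    case True
    then obtain m where m: "m < length ys" "zs ! l = ys ! m" by (metis in_set_conv_nth)
    have "(\<Sum>k<length ys. if ys ! k = zs ! l then g l else 0)
        = (\<Sum>k<length ys. if m = k then g l else 0)"
      using m assms(1) by (intro sum.cong) (auto simp: nth_eq_iff_index_eq)
    then show ?thesis using m by simp
  next
    case False
    then show ?thesis using g0[OF l] by (auto intro!: sum.neutral)
  qed
  have "(\<Sum>k<length ys. f k) = (\<Sum>k<length ys. \<Sum>l<length zs. if ys ! k = zs ! l then g l else 0)"
    using row by simp
  also have "\<dots> = (\<Sum>l<length zs. \<Sum>k<length ys. if ys ! k = zs ! l then g l else 0)"
    by (rule sum.swap)
  also have "\<dots> = (\<Sum>l<length zs. g l)"
    using col by simp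
  finally show ?thesis .
qed

lemma image_mset_sum: "image_mset f (\<Sum>i\<in>I. A i) = (\<Sum>i\<in>I. image_mset f (A i))"
  by (induction I rule: infinite_finite_induct) auto

lemma not_distinct_split:
  assumes "\<not> distinct ys"
  obtains us a ws vs where "ys = us @ a # ws @ a # vs"
  using not_distinct_decomp[OF assms] that by auto

section \<open>Powers of \<open>\<epsilon>\<close>, signs and cancelling pairs\<close>

context tract
begin

lemma eps_pow_unit: "tract_eps F [^] (k::nat) \<in> tract_units F"
  by (induction k) (auto simp: one_unit eps_unit unit_mult)

lemma eps_pow_carrier: "tract_eps F [^] (k::nat) \<in> carrier F"
  by (simp add: eps_carrier)

lemma eps_pow_square: "tract_eps F [^] (k::nat) \<otimes> tract_eps F [^] k = \<one>"
  using eps_carrier by (simp add: eps_eps flip: nat_pow_distrib)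

lemma sign_unit: "tract_sign F zs \<in> tract_units F"
  by (simp add: tract_sign_def one_unit eps_unit)

lemma sign_carrier: "tract_sign F zs \<in> carrier F"
  using sign_unit unit_carrier by blast

lemma unit_mult_eq_zero_iff:
  "c \<in> tract_units F \<Longrightarrow> a \<in> carrier F \<Longrightarrow> c \<otimes> a = tzero F \<longleftrightarrow> a = tzero F"
  using unit_mult[of c a] tzero_absorb'[of c] by (auto simp: tract_units_def)

lemma formal_zero: "formal F (tzero F) = {#}"
  by (simp add: formal_def)

text \<open>For nonzero \<open>t\<close> this is the null sum \<open>1 + \<epsilon>\<close>
  multiplied by \<open>t\<close>; for \<open>t = 0\<close> both summands are empty.\<close>

lemma formal_cancel:
  assumes "t \<in> carrier F"
  shows "formal F t + formal F (tract_eps F \<otimes> t) \<in> nullset F"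
proof (cases "t = tzero F")
  case True
  then show ?thesis using zero_in_nullset tzero_absorb'[OF eps_carrier] by (simp add: formal_zero)
next
  case False
  then have "t \<in> tract_units F" using assms by (simp add: tract_units_def)
  from nullset_stable[OF this eps_null] show ?thesis
    using False assms eps_carrier unit_mult_eq_zero_iff[OF eps_unit assms]
    by (simp add: formal_def m_comm add_mset_commute)
qed

section \<open>Moving one entry through a tuple\<close>

text \<open>Each adjacent swap past an entry of \<open>ws\<close> costs one factor
  \<open>\<epsilon>\<close>. The function \<open>g\<close> is abstract so that alternating functions
  and signs are both covered; the fixed multiset \<open>A\<close> carries side conditions, such as
  distinctness, through all intermediate lists.\<close>

lemma move_entry:
  assumes swap: "\<And>us b vs. mset (us @ b # a # vs) = A \<Longrightarrow>
      g (us @ b # a # vs) = tract_eps F \<otimes> g (us @ a # b # vs)"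
    and carr: "\<And>zs. g zs \<in> carrier F"
    and "mset (us @ a # ws @ vs) = A"
  shows "g (us @ ws @ a # vs) = tract_eps F [^] length ws \<otimes> g (us @ a # ws @ vs)"
  using assms(3)
proof (induction ws arbitrary: us)
  case Nil
  then show ?case using carr by simp
next
  case (Cons b ws)
  have "g (us @ (b # ws) @ a # vs) = tract_eps F [^] length ws \<otimes> g (us @ b # a # ws @ vs)"
    using Cons.IH[of "us @ [b]"] Cons.prems by (simp add: ac_simps add_mset_commute)
  also have "g (us @ b # a # ws @ vs) = tract_eps F \<otimes> g (us @ a # b # ws @ vs)"
    using Cons.prems by (intro swap) (simp add: ac_simps add_mset_commute)
  finally show ?case using carr eps_carrier by (simp add: m_assoc)
qed

lemma alternating_move_entry:
  assumes alt: "alternating F n r \<phi>" and carr: "\<And>zs. \<phi> zs \<in> carrier F"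
    and t: "us @ a # ws @ vs \<in> tuples n r"
  shows "\<phi> (us @ ws @ a # vs) = tract_eps F [^] length ws \<otimes> \<phi> (us @ a # ws @ vs)"
proof (rule move_entry[OF _ carr refl])
  fix us' b vs' assume m: "mset (us' @ b # a # vs') = mset (us @ a # ws @ vs)"
  have t': "us' @ a # b # vs' \<in> tuples n r"
    using mset_eq_length[OF m] mset_eq_setD[OF m] t unfolding tuples_def
    by (simp add: insert_commute)
  have "(us' @ a # b # vs')[length us' := (us' @ a # b # vs') ! Suc (length us'),
      Suc (length us') := (us' @ a # b # vs') ! length us'] = us' @ b # a # vs'"
    by (simp add: list_update_append nth_append)
  moreover have "Suc (length us') < r" using t' by (simp add: tuples_def)
  ultimately show "\<phi> (us' @ b # a # vs') = tract_eps F \<otimes> \<phi> (us' @ a # b # vs')"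
    using alt t' unfolding alternating_def by (metis lessI)
qed

lemma sign_move_entry:
  assumes "distinct (us @ a # ws @ vs)" "set (us @ a # ws @ vs) = {1..length (us @ a # ws @ vs)}"
  shows "tract_sign F (us @ ws @ a # vs)
    = tract_eps F [^] length ws \<otimes> tract_sign F (us @ a # ws @ vs)"
proof (rule move_entry[OF _ sign_carrier refl])
  fix us' b vs' assume m: "mset (us' @ b # a # vs') = mset (us @ a # ws @ vs)"
  let ?zs = "us' @ a # b # vs'"
  have m': "mset ?zs = mset (us @ a # ws @ vs)" using m by (simp add: ac_simps add_mset_commute)
  have "distinct ?zs" "set ?zs = {1..length ?zs}"
    using mset_eq_length[OF m'] mset_eq_setD[OF m'] mset_eq_imp_distinct_iff[OF m'] assms by auto
  from tract_sign_swap[OF this, of "length us'" "Suc (length us')"]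
  show "tract_sign F (us' @ b # a # vs') = tract_eps F \<otimes> tract_sign F ?zs"
    by (simp add: list_update_append nth_append)
qed

text \<open>Induction on \<open>us\<close>: first its head goes to the very end, past
  \<open>us @ vs\<close>, then the remaining \<open>us\<close> passes \<open>vs @ [a]\<close>. This
  passes \<open>us\<close> twice, and the corresponding powers of \<open>\<epsilon>\<close>
  cancel.\<close>

lemma sign_rotate:
  assumes "distinct (us @ vs)" "set (us @ vs) = {1..length (us @ vs)}"
  shows "tract_sign F (vs @ us) = tract_eps F [^] (length us * length vs) \<otimes> tract_sign F (us @ vs)"
  using assms
proof (induction us arbitrary: vs)
  case Nil
  then show ?case using sign_carrier by simp
next
  case (Cons a us)
  have "tract_sign F (vs @ a # us)
      = tract_eps F [^] (length us * Suc (length vs)) \<otimes> tract_sign F (us @ vs @ [a])"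
    using Cons.IH[of "vs @ [a]"] Cons.prems by auto
  also have "tract_sign F (us @ vs @ [a])
      = tract_eps F [^] (length us + length vs) \<otimes> tract_sign F (a # us @ vs)"
    using sign_move_entry[of "[]" a "us @ vs" "[]"] Cons.prems by simp
  finally have "tract_sign F (vs @ a # us) = tract_eps F [^] (length us * Suc (length vs))
      \<otimes> tract_eps F [^] (length us + length vs) \<otimes> tract_sign F (a # us @ vs)"
    using eps_pow_carrier sign_carrier by (simp add: m_assoc)
  also have "tract_eps F [^] (length us * Suc (length vs)) \<otimes> tract_eps F [^] (length us + length vs)
      = tract_eps F [^] (length us + length us) \<otimes> tract_eps F [^] (length us * length vs + length vs)"
    using eps_carrier by (simp add: nat_pow_mult algebra_simps)
  also have "tract_eps F [^] (length us + length us) = \<one>"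
    using eps_pow_square eps_carrier by (simp flip: nat_pow_mult)
  finally show ?case using eps_carrier by (simp add: add.commute)
qed

section \<open>Ranks, classes and repeated entries\<close>

text \<open>A tuple with nonzero value consists of \<open>r\<close> distinct elements of
  \<open>{1..n}\<close>. The bound keeps \<open>n - r\<close> from truncating.\<close>

lemma gp_rank_le:
  assumes "gp_function F n r \<phi>"
  shows "r \<le> n"
proof -
  obtain xs where "xs \<in> tuples n r" "distinct xs"
    using assms by (auto simp: gp_function_def alternating_def)
  then show ?thesis
    using card_mono[of "{1..n}" "set xs"] distinct_card[of xs] by (simp add: tuples_def)
qed

lemma gp_class_scale:
  assumes c: "c \<in> tract_units F" and carr: "\<And>xs. \<phi> xs \<in> carrier F"
  shows "gp_class F (\<lambda>xs. c \<otimes> \<phi> xs) = gp_class F \<phi>"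
proof -
  obtain b where b: "b \<in> tract_units F" "b \<otimes> c = \<one>" using unit_inv[OF c] by metis
  have "(\<lambda>xs. d \<otimes> (c \<otimes> \<phi> xs)) = (\<lambda>xs. (d \<otimes> c) \<otimes> \<phi> xs)" if "d \<in> tract_units F" for d
    using that c carr unit_carrier by (simp add: m_assoc)
  moreover have "(\<lambda>xs. d \<otimes> \<phi> xs) = (\<lambda>xs. (d \<otimes> b) \<otimes> (c \<otimes> \<phi> xs))" if "d \<in> tract_units F" for d
  proof
    fix xs
    have "(d \<otimes> b) \<otimes> (c \<otimes> \<phi> xs) = d \<otimes> (b \<otimes> c) \<otimes> \<phi> xs"
      using that b(1) c carr[of xs] by (simp add: unit_carrier m_assoc)
    then show "d \<otimes> \<phi> xs = (d \<otimes> b) \<otimes> (c \<otimes> \<phi> xs)" using b(2) that by (simp add: unit_carrier)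
  qed
  ultimately show ?thesis
    unfolding gp_class_def set_eq_iff mem_Collect_eq using b(1) c unit_mult by metis
qed

lemma self_in_gp_class:
  assumes "\<And>xs. \<phi> xs \<in> carrier F"
  shows "\<phi> \<in> gp_class F \<phi>"
proof -
  have "\<phi> = (\<lambda>xs. \<one> \<otimes> \<phi> xs)" using assms by simp
  then show ?thesis using one_unit unfolding gp_class_def by blast
qed

text \<open>Omitting an entry other than two chosen equal ones leaves a repetition, so at most two
  terms survive, and moving \<open>a\<close> past \<open>ws\<close> shows that they form a
  cancelling pair. The factor \<open>h\<close> may be any function of the omitted entry; this covers
  the second function of the relation with its other arguments fixed.\<close>

lemma sum_repeated_entry_null:
  assumes alt: "alternating F n w \<nu>" and carr: "\<And>zs. \<nu> zs \<in> carrier F"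
    and h: "\<And>a. h a \<in> carrier F"
    and ys: "ys \<in> tuples n (w + 1)" "\<not> distinct ys"
  shows "(\<Sum>k<w + 1. formal F (tract_eps F [^] Suc k \<otimes>
            (\<nu> (take k ys @ drop (Suc k) ys) \<otimes> h (ys ! k)))) \<in> nullset F"
proof -
  let ?t = "\<lambda>k. tract_eps F [^] Suc k \<otimes> (\<nu> (take k ys @ drop (Suc k) ys) \<otimes> h (ys ! k))"
  obtain us a ws vs where split: "ys = us @ a # ws @ a # vs"
    using not_distinct_split[OF ys(2)] .
  define i where "i = length us"
  define j where "j = Suc (length us + length ws)"
  have ij: "i < j" "j < w + 1" using ys(1) by (auto simp: i_def j_def tuples_def split)
  have sub: "take k ys @ drop (Suc k) ys \<in> tuples n w" if "k < w + 1" for k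
    using ys(1) that by (auto simp: tuples_def dest: in_set_takeD in_set_dropD)
  have zero: "?t k = tzero F" if k: "k < w + 1" "k \<noteq> i" "k \<noteq> j" for k
  proof -
    have len: "length ys = w + 1" using ys(1) by (simp add: tuples_def)
    have eq: "ys ! i = ys ! j" by (simp add: split i_def j_def nth_append)
    have "\<not> distinct (take k ys @ drop (Suc k) ys)"
    proof
      assume d: "distinct (take k ys @ drop (Suc k) ys)"
      \<comment> \<open>The position to which entry \<open>m\<close> of \<open>ys\<close> shifts
        once entry \<open>k\<close> is removed.\<close>
      let ?p = "\<lambda>m. if m < k then m else m - 1"
      have "(take k ys @ drop (Suc k) ys) ! ?p m = ys ! m" if "m < w + 1" "m \<noteq> k" for m
        using that k(1) len by (auto simp: nth_append)
      then have "(take k ys @ drop (Suc k) ys) ! ?p i = (take k ys @ drop (Suc k) ys) ! ?p j"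
        using eq ij k by simp
      moreover have "?p i < length (take k ys @ drop (Suc k) ys)"
        "?p j < length (take k ys @ drop (Suc k) ys)"
        using ij k len by auto
      ultimately have "?p i = ?p j" using d nth_eq_iff_index_eq by blast
      then show False using ij k by (auto split: if_splits)
    qed
    then have "\<nu> (take k ys @ drop (Suc k) ys) = tzero F"
      using alt sub[OF k(1)] unfolding alternating_def by blast
    then show ?thesis using tzero_absorb[OF h] tzero_absorb'[OF eps_pow_carrier, of "Suc k"]
      by (simp del: nat_pow_Suc)
  qed
  have "(\<Sum>k<w + 1. formal F (?t k)) = (\<Sum>k\<in>{i, j}. formal F (?t k))"
    using ij zero by (intro sum.mono_neutral_right) (auto simp: formal_zero simp del: nat_pow_Suc)
  also have "\<dots> = formal F (?t i) + formal F (?t j)" using ij by simp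
  also have "?t j = tract_eps F \<otimes> ?t i"
  proof -
    have ti: "take i ys @ drop (Suc i) ys = us @ ws @ a # vs"
      by (simp add: split i_def)
    have tj: "take j ys @ drop (Suc j) ys = us @ a # ws @ vs"
      by (simp add: split j_def)
    have aa: "ys ! i = a" "ys ! j = a" by (simp_all add: split i_def j_def nth_append)
    let ?l = "length ws" and ?v = "\<nu> (us @ a # ws @ vs)"
    have \<nu>i: "\<nu> (us @ ws @ a # vs) = tract_eps F [^] ?l \<otimes> ?v"
      using sub[OF ij(2)] by (intro alternating_move_entry[OF alt carr]) (simp only: tj)
    have "tract_eps F \<otimes> ?t i = (tract_eps F \<otimes> (tract_eps F [^] Suc i \<otimes> tract_eps F [^] ?l)) \<otimes> (?v \<otimes> h a)"
      unfolding ti aa \<nu>i using carr h eps_carrier eps_pow_carrier by (simp add: m_ac del: nat_pow_Suc)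
    \<comment> \<open>The exponents agree because \<open>j = i + length ws + 1\<close>.\<close>
    also have "tract_eps F \<otimes> (tract_eps F [^] Suc i \<otimes> tract_eps F [^] ?l) = tract_eps F [^] Suc j"
      using eps_carrier by (simp add: i_def j_def m_ac flip: nat_pow_mult)
    finally show ?thesis unfolding tj aa by simp
  qed
  also have "formal F (?t i) + formal F (tract_eps F \<otimes> ?t i) \<in> nullset F"
    by (intro formal_cancel m_closed eps_pow_carrier carr h)
  finally show ?thesis .
qed

end

section \<open>The involution on units, signs and formal sums\<close>

locale involutive_tract = tract F for F :: "('a, 'b) tract_scheme" (structure) +
  fixes \<tau> :: "'a \<Rightarrow> 'a"
  assumes involution: "tract_involution F \<tau>"
begin

lemma \<tau>_hom: "\<tau> \<in> hom F F"
  and \<tau>_one: "\<tau> \<one> = \<one>"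
  and \<tau>_zero: "\<tau> (tzero F) = tzero F"
  and \<tau>_null: "A \<in> nullset F \<Longrightarrow> image_mset \<tau> A \<in> nullset F"
  and \<tau>_\<tau>: "x \<in> carrier F \<Longrightarrow> \<tau> (\<tau> x) = x"
  using involution by (auto simp: tract_involution_def tract_morphism_def)

lemma \<tau>_carrier: "x \<in> carrier F \<Longrightarrow> \<tau> x \<in> carrier F"
  using \<tau>_hom hom_in_carrier by metis

lemma \<tau>_mult: "x \<in> carrier F \<Longrightarrow> y \<in> carrier F \<Longrightarrow> \<tau> (x \<otimes> y) = \<tau> x \<otimes> \<tau> y"
  using \<tau>_hom hom_mult by metis

lemma \<tau>_eq_zero_iff: "x \<in> carrier F \<Longrightarrow> \<tau> x = tzero F \<longleftrightarrow> x = tzero F"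
  using \<tau>_\<tau> \<tau>_zero by metis

lemma \<tau>_unit: "x \<in> tract_units F \<Longrightarrow> \<tau> x \<in> tract_units F"
  using \<tau>_carrier \<tau>_eq_zero_iff by (simp add: tract_units_def)

lemma \<tau>_eps_pow: "\<tau> (tract_eps F [^] (k::nat)) = tract_eps F [^] k"
  by (induction k) (simp_all add: \<tau>_one \<tau>_mult eps_carrier involution_eps[OF involution])

lemma \<tau>_sign: "\<tau> (tract_sign F zs) = tract_sign F zs"
  by (simp add: tract_sign_def \<tau>_one involution_eps[OF involution])

lemma formal_\<tau>: "x \<in> carrier F \<Longrightarrow> formal F (\<tau> x) = image_mset \<tau> (formal F x)"
  by (simp add: formal_def \<tau>_eq_zero_iff)

section \<open>The dual of a function on tuples\<close>

abbreviation dfun :: "nat \<Rightarrow> nat \<Rightarrow> (nat list \<Rightarrow> 'a) \<Rightarrow> nat list \<Rightarrow> 'a" where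
  "dfun \<equiv> dual_fun F \<tau>"

lemma dual_fun_carrier: "(\<And>xs. \<phi> xs \<in> carrier F) \<Longrightarrow> dfun n r \<phi> xs \<in> carrier F"
  by (simp add: dual_fun_def Let_def sign_carrier \<tau>_carrier tzero_closed)

text \<open>Swapping two entries of \<open>xs\<close> leaves the listed complement
  \<open>?zs\<close> unchanged, so only the sign factor reacts.\<close>

lemma dual_fun_alternating:
  assumes "r \<le> n" and carr: "\<And>xs. \<phi> xs \<in> carrier F"
  shows "alternating F n (n - r) (dfun n r \<phi>)"
  unfolding alternating_def
proof (intro ballI conjI allI impI)
  fix xs i j assume xs: "xs \<in> tuples n (n - r)" and ij: "i < j \<and> j < n - r"
  let ?xs = "xs[i := xs ! j, j := xs ! i]"
  let ?zs = "sorted_list_of_set ({1..n} - set xs)"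
  have len: "length xs = n - r" "set xs \<subseteq> {1..n}" using xs by (auto simp: tuples_def)
  have s: "set ?xs = set xs" "distinct ?xs \<longleftrightarrow> distinct xs" using ij len by auto
  have t: "?xs \<in> tuples n (n - r)" using xs s(1) unfolding tuples_def by simp
  show "dfun n r \<phi> ?xs = tract_eps F \<otimes> dfun n r \<phi> xs"
  proof (cases "distinct xs")
    case True
    have d: "distinct (xs @ ?zs)" "set (xs @ ?zs) = {1..n}" using True len(2) by auto
    have "length (xs @ ?zs) = n" using distinct_card[OF d(1)] d(2) by simp
    then have "tract_sign F ((xs @ ?zs)[i := (xs @ ?zs) ! j, j := (xs @ ?zs) ! i])
        = tract_eps F \<otimes> tract_sign F (xs @ ?zs)"
      using d ij len(1) by (intro tract_sign_swap) auto
    moreover have "(xs @ ?zs)[i := (xs @ ?zs) ! j, j := (xs @ ?zs) ! i] = ?xs @ ?zs"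
      using ij len(1) by (simp add: list_update_append nth_append)
    ultimately have "tract_sign F (?xs @ ?zs) = tract_eps F \<otimes> tract_sign F (xs @ ?zs)" by simp
    then show ?thesis
      using True xs t s carr eps_carrier
      by (simp add: dual_fun_def Let_def m_assoc sign_carrier \<tau>_carrier)
  next
    case False
    then show ?thesis using s tzero_absorb'[OF eps_carrier] by (simp add: dual_fun_def)
  qed
next
  fix xs :: "nat list" assume "\<not> distinct xs"
  then show "dfun n r \<phi> xs = tzero F" by (simp add: dual_fun_def)
qed

text \<open>Dualization is conjugate-linear, which is why it descends to classes modulo
  units.\<close>

lemma dual_fun_scale:
  assumes "c \<in> carrier F" "\<And>xs. \<phi> xs \<in> carrier F"
  shows "dfun n r (\<lambda>xs. c \<otimes> \<phi> xs) xs = \<tau> c \<otimes> dfun n r \<phi> xs"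
  using assms
  by (simp add: dual_fun_def Let_def \<tau>_mult \<tau>_carrier sign_carrier m_lcomm tzero_absorb')

section \<open>Duality and the relations between two functions\<close>

lemma pluecker_rel_dual:
  assumes \<nu>: "gp_function F n w \<nu>" and \<mu>: "gp_function F n r \<mu>"
    and rel: "pluecker_rel F n w \<nu> r \<mu>"
  shows "pluecker_rel F n (n - r) (dfun n r \<mu>) (n - w) (dfun n w \<nu>)"
  unfolding pluecker_rel_def
proof (intro impI ballI)
  fix ys xs assume w: "1 \<le> n - w"
    and ys: "ys \<in> tuples n (n - r + 1)" and xs: "xs \<in> tuples n (n - w - 1)"
  note c\<nu> = gp_function_carrier[OF \<nu>] and c\<mu> = gp_function_carrier[OF \<mu>]
  note cd\<nu> = dual_fun_carrier[of \<nu>, OF c\<nu>] and cd\<mu> = dual_fun_carrier[of \<mu>, OF c\<mu>]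
  have rn: "r \<le> n" using gp_rank_le[OF \<mu>] .
  let ?e = "tract_eps F"
  let ?t = "\<lambda>k. ?e [^] Suc k \<otimes>
    (dfun n r \<mu> (take k ys @ drop (Suc k) ys) \<otimes> dfun n w \<nu> (ys ! k # xs))"
  have vanish: "?t k = tzero F"
    if "dfun n w \<nu> (ys ! k # xs) = tzero F" for k
    using that cd\<mu> eps_carrier by (simp add: tzero_absorb')
  show "(\<Sum>k<n - r + 1. formal F (?t k)) \<in> nullset F"
  proof (cases "distinct ys")
    case False
    then show ?thesis
      using sum_repeated_entry_null[OF dual_fun_alternating[of _ _ \<mu>, OF rn c\<mu>] cd\<mu> _ ys,
          of "\<lambda>a. dfun n w \<nu> (a # xs)"] cd\<nu> by blast
  next
    case dy: True
    show ?thesis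
    proof (cases "distinct xs")
      case False
      then have "?t k = tzero F" for k by (intro vanish) (simp add: dual_fun_def)
      then show ?thesis using zero_in_nullset by (simp add: formal_zero del: nat_pow_Suc)
    next
      case dx: True
      define xs' where "xs' = sorted_list_of_set ({1..n} - set ys)"
      define ys' where "ys' = sorted_list_of_set ({1..n} - set xs)"
      have sx: "set xs' = {1..n} - set ys" "distinct xs'"
        and sy: "set ys' = {1..n} - set xs" "distinct ys'"
        by (simp_all add: xs'_def ys'_def)
      have lens: "length ys = n - r + 1" "set ys \<subseteq> {1..n}" "length xs = n - w - 1" "set xs \<subseteq> {1..n}"
        using ys xs by (auto simp: tuples_def)
      have "length (ys @ xs') = n"
        using distinct_card[of "ys @ xs'"] dy sx lens(2) by (simp add: Un_absorb1)
      \<comment> \<open>Since \<open>ys\<close> consists of \<open>n - r + 1\<close> distinct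
        elements of \<open>{1..n}\<close>, the case \<open>r = 0\<close> cannot occur here, and the
        given relation is not the empty condition.\<close>
      then have r: "1 \<le> r" and lx': "length xs' = r - 1" using lens(1) rn by auto
      have "length (xs @ ys') = n"
        using distinct_card[of "xs @ ys'"] dx sy lens(4) by (simp add: Un_absorb1)
      then have ly': "length ys' = w + 1" using lens(3) w by auto
      let ?s = "\<lambda>l. ?e [^] Suc l \<otimes> (\<nu> (take l ys' @ drop (Suc l) ys') \<otimes> \<mu> (ys' ! l # xs'))"
      have cs: "?s l \<in> carrier F" for l
        by (intro m_closed eps_pow_carrier c\<nu> c\<mu>)
      \<comment> \<open>Collects the signs and powers of \<open>\<epsilon>\<close> that remain in a
        matched pair of terms once everything depending on \<open>k\<close> and \<open>l\<close> has
        been absorbed.\<close>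
      define c where "c = ?e [^] (n - r) \<otimes> ?e [^] (n - w - 1)
        \<otimes> (tract_sign F (ys @ xs') \<otimes> tract_sign F (xs @ ys'))"
      have c: "c \<in> tract_units F"
        unfolding c_def by (intro unit_mult eps_pow_unit sign_unit)
      have match: "?t k = c \<otimes> \<tau> (?s l)"
        if k: "k < length ys" and l: "l < length ys'" and kl: "ys ! k = ys' ! l" for k l
      proof -
        define a where "a = ys ! k"
        let ?u = "take k ys" and ?v = "drop (Suc k) ys" and ?u' = "take l ys'" and ?v' = "drop (Suc l) ys'"
        have ysk: "ys @ xs' = ?u @ a # ?v @ xs'"
          using arg_cong[OF id_take_nth_drop[OF k], of "\<lambda>z. z @ xs'"] by (simp add: a_def)
        have ysl: "xs @ ys' = xs @ ?u' @ a # ?v'"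
          using arg_cong[OF id_take_nth_drop[OF l], of "\<lambda>z. xs @ z"] kl by (simp add: a_def)
        have A: "distinct (?u @ a # ?v @ xs')" "set (?u @ a # ?v @ xs') = {1..n}"
          unfolding ysk[symmetric] using dy sx lens(2) by auto
        have A': "length (?u @ a # ?v @ xs') = n" using distinct_card[OF A(1)] A(2) by simp
        have B: "distinct (xs @ ?u' @ a # ?v')" "set (xs @ ?u' @ a # ?v') = {1..n}"
          unfolding ysl[symmetric] using dx sy lens(4) by auto
        have B': "length (xs @ ?u' @ a # ?v') = n" using distinct_card[OF B(1)] B(2) by simp
        \<comment> \<open>The complement of \<open>?u @ ?v\<close> is listed as
          \<open>a # xs'\<close> instead of increasingly, so that \<open>\<mu>\<close> receives the
          same argument as in \<open>?s l\<close>.\<close>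
        have "dfun n r \<mu> (?u @ ?v) = tract_sign F ((?u @ ?v) @ a # xs') \<otimes> \<tau> (\<mu> (a # xs'))"
          using A r lx' by (intro dual_fun_eq[OF involution \<mu>]) auto
        \<comment> \<open>Here \<open>a\<close> stands behind \<open>?v\<close>, that is,
          \<open>n - r - k\<close> places after its position in \<open>ys\<close>.\<close>
        also have "tract_sign F ((?u @ ?v) @ a # xs')
            = ?e [^] (n - r - k) \<otimes> tract_sign F (ys @ xs')"
          unfolding ysk using sign_move_entry[of ?u a ?v xs'] A A' lens(1) by simp
        finally have 1: "dfun n r \<mu> (?u @ ?v)
          = ?e [^] (n - r - k) \<otimes> tract_sign F (ys @ xs') \<otimes> \<tau> (\<mu> (a # xs'))" .
        have "dfun n w \<nu> (a # xs) = tract_sign F ((a # xs) @ ?u' @ ?v') \<otimes> \<tau> (\<nu> (?u' @ ?v'))"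
          using B B' l ly' by (intro dual_fun_eq[OF involution \<nu>]) auto
        also have "tract_sign F ((a # xs) @ ?u' @ ?v')
            = ?e [^] (n - w - 1 + l) \<otimes> tract_sign F (xs @ ys')"
        proof -
          let ?m = "n - w - 1 + l"
          \<comment> \<open>From the front, \<open>a\<close> passes the \<open>n - w - 1\<close>
            entries of \<open>xs\<close> and the \<open>l\<close> entries of \<open>?u'\<close>. The
            equation is then solved for the other sign, \<open>?e [^] ?m\<close> being its own
            inverse.\<close>
          have "tract_sign F (xs @ ys') = ?e [^] ?m \<otimes> tract_sign F ((a # xs) @ ?u' @ ?v')"
            unfolding ysl using sign_move_entry[of "[]" a "xs @ ?u'" ?v'] B B' lens(3) l by simp
          then have "?e [^] ?m \<otimes> tract_sign F (xs @ ys')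
              = (?e [^] ?m \<otimes> ?e [^] ?m) \<otimes> tract_sign F ((a # xs) @ ?u' @ ?v')"
            using eps_pow_carrier sign_carrier by (simp add: m_assoc)
          then show ?thesis using eps_pow_square sign_carrier by simp
        qed
        finally have 2: "dfun n w \<nu> (a # xs)
          = ?e [^] (n - w - 1 + l) \<otimes> tract_sign F (xs @ ys') \<otimes> \<tau> (\<nu> (?u' @ ?v'))" .
        have 3: "\<tau> (?s l) = ?e [^] Suc l \<otimes> (\<tau> (\<nu> (?u' @ ?v')) \<otimes> \<tau> (\<mu> (a # xs')))"
          using c\<nu> c\<mu> kl unfolding a_def
          by (simp only: \<tau>_mult \<tau>_eps_pow eps_pow_carrier m_closed)
        have "?t k = (?e [^] Suc k \<otimes> ?e [^] (n - r - k) \<otimes> ?e [^] (n - w - 1 + l))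
            \<otimes> (tract_sign F (ys @ xs') \<otimes> tract_sign F (xs @ ys'))
            \<otimes> (\<tau> (\<nu> (?u' @ ?v')) \<otimes> \<tau> (\<mu> (a # xs')))"
          unfolding a_def[symmetric] 1 2
          by (simp only: m_ac m_closed eps_pow_carrier sign_carrier \<tau>_carrier c\<nu> c\<mu>)
        \<comment> \<open>The exponent loses its dependence on \<open>k\<close> because
          \<open>k \<le> n - r\<close>; the remaining \<open>Suc l\<close> is the exponent needed in
          \<open>?s l\<close>.\<close>
        also have "?e [^] Suc k \<otimes> ?e [^] (n - r - k) \<otimes> ?e [^] (n - w - 1 + l)
            = ?e [^] (n - r) \<otimes> ?e [^] (n - w - 1) \<otimes> ?e [^] Suc l"
          unfolding nat_pow_mult[OF eps_carrier] using k lens(1)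
          by (intro arg_cong[where f = "\<lambda>m. ?e [^] m"]) simp
        finally show ?thesis
          unfolding 3 c_def
          by (simp only: m_ac m_closed eps_pow_carrier sign_carrier \<tau>_carrier c\<nu> c\<mu>)
      qed
      have "(\<Sum>k<length ys. formal F (?t k)) = (\<Sum>l<length ys'. formal F (c \<otimes> \<tau> (?s l)))"
      proof (rule sum_matching_entries[OF dy sy(2)])
        fix k l assume "k < length ys" "l < length ys'" "ys ! k = ys' ! l"
        then show "formal F (?t k) = formal F (c \<otimes> \<tau> (?s l))" by (rule arg_cong[OF match])
      next
        \<comment> \<open>Without a partner, \<open>ys ! k\<close> lies in \<open>xs\<close>, so the
          second factor of the dual relation has a repeated argument.\<close>
        fix k assume k: "k < length ys" "ys ! k \<notin> set ys'"
        then have "ys ! k \<in> set xs" using lens(2) sy(1) nth_mem by blast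
        then have "?t k = tzero F" by (intro vanish) (simp add: dual_fun_def)
        then show "formal F (?t k) = 0" by (simp only: formal_zero)
      next
        \<comment> \<open>Symmetrically, \<open>ys' ! l\<close> lies in \<open>xs'\<close>, and
          \<open>\<mu>\<close> vanishes at a tuple with a repetition.\<close>
        fix l assume l: "l < length ys'" "ys' ! l \<notin> set ys"
        then have "ys' ! l \<in> set xs'" using sy(1) sx(1) nth_mem by blast
        moreover have "ys' ! l # xs' \<in> tuples n r"
          using sx(1) sy(1) nth_mem[OF l(1)] lx' r by (auto simp: tuples_def)
        ultimately have "\<mu> (ys' ! l # xs') = tzero F"
          using \<mu> by (auto simp: gp_function_def alternating_def)
        then have "c \<otimes> \<tau> (?s l) = tzero F"
          using c\<nu> eps_carrier unit_carrier[OF c] by (simp add: \<tau>_zero tzero_absorb')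
        then show "formal F (c \<otimes> \<tau> (?s l)) = 0" by (simp only: formal_zero)
      qed
      also have "\<dots> = (\<Sum>l<length ys'. image_mset (\<lambda>x. c \<otimes> x) (image_mset \<tau> (formal F (?s l))))"
        by (simp only: formal_scale[OF c \<tau>_carrier[OF cs]] formal_\<tau>[OF cs])
      also have "\<dots> = image_mset (\<lambda>x. c \<otimes> x) (image_mset \<tau> (\<Sum>l<length ys'. formal F (?s l)))"
        by (simp only: image_mset_sum)
      also have "\<dots> \<in> nullset F"
      proof (intro nullset_stable[OF c] \<tau>_null)
        have "ys' \<in> tuples n (w + 1)" "xs' \<in> tuples n (r - 1)"
          using sx sy lx' ly' by (auto simp: tuples_def)
        then show "(\<Sum>l<length ys'. formal F (?s l)) \<in> nullset F"
          using rel r unfolding pluecker_rel_def ly' by blast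
      qed
      finally show ?thesis unfolding lens(1) .
    qed
  qed
qed

section \<open>Dual matroids and double duals\<close>

text \<open>The relations are the case \<open>\<nu> = \<mu>\<close> of
  \<open>pluecker_rel_dual\<close>. A nonzero value is found at the complement of a tuple where
  \<open>\<phi>\<close> is nonzero.\<close>

lemma dual_fun_gp:
  assumes \<phi>: "gp_function F n r \<phi>"
  shows "gp_function F n (n - r) (dfun n r \<phi>)"
proof -
  note carr = gp_function_carrier[OF \<phi>]
  have "\<exists>xs\<in>tuples n (n - r). dfun n r \<phi> xs \<noteq> tzero F"
  proof -
    obtain ys where ys: "ys \<in> tuples n r" "\<phi> ys \<noteq> tzero F" "distinct ys"
      using \<phi> by (auto simp: gp_function_def alternating_def)
    define xs where "xs = sorted_list_of_set ({1..n} - set ys)"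
    have d: "distinct (xs @ ys)" "set (xs @ ys) = {1..n}" "length ys = r"
      using ys by (auto simp: xs_def tuples_def)
    have "length xs + r = n" using distinct_card[OF d(1)] d(2,3) by simp
    then have "xs \<in> tuples n (n - r)" using d(2) by (auto simp: tuples_def)
    moreover have "dfun n r \<phi> xs \<noteq> tzero F"
      using dual_fun_eq[OF involution \<phi> d] unit_mult_eq_zero_iff[OF sign_unit \<tau>_carrier[OF carr]]
        \<tau>_eq_zero_iff[OF carr] ys(2) by simp
    ultimately show ?thesis by blast
  qed
  moreover have "pluecker_rel F n (n - r) (dfun n r \<phi>) (n - r) (dfun n r \<phi>)"
    using pluecker_rel_dual[OF \<phi> \<phi>] \<phi> by (simp add: gp_function_def)
  moreover have "dfun n r \<phi> xs = tzero F" if "xs \<notin> tuples n (n - r)" for xs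
    using that by (simp add: dual_fun_def)
  ultimately show ?thesis
    unfolding gp_function_def
    using dual_fun_carrier[of \<phi>, OF carr] dual_fun_alternating[of _ _ \<phi>, OF gp_rank_le[OF \<phi>] carr] by blast
qed

text \<open>The two conjugations cancel, and the two signs differ by exchanging blocks of lengths
  \<open>r\<close> and \<open>n - r\<close>, whence the exponent \<open>r * (n - r)\<close>.\<close>

lemma dual_fun_dual_fun:
  assumes \<phi>: "gp_function F n r \<phi>"
  shows "dfun n (n - r) (dfun n r \<phi>) xs = tract_eps F [^] (r * (n - r)) \<otimes> \<phi> xs"
proof (cases "xs \<in> tuples n r \<and> distinct xs")
  case False
  then have "\<phi> xs = tzero F" using \<phi> by (auto simp: gp_function_def alternating_def)
  then show ?thesis
    using False gp_rank_le[OF \<phi>] tzero_absorb'[OF eps_pow_carrier] by (auto simp: dual_fun_def)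
next
  case True
  define ys where "ys = sorted_list_of_set ({1..n} - set xs)"
  have d: "distinct (xs @ ys)" "set (xs @ ys) = {1..n}" "length xs = r"
    using True by (auto simp: ys_def tuples_def)
  then have d': "distinct (ys @ xs)" "set (ys @ xs) = {1..n}" by auto
  have len: "length (xs @ ys) = n" using distinct_card[OF d(1)] d(2) by simp
  then have ly: "length ys = n - r" using d(3) by auto
  have "dfun n (n - r) (dfun n r \<phi>) xs = tract_sign F (xs @ ys) \<otimes> \<tau> (dfun n r \<phi> ys)"
    using d ly by (intro dual_fun_eq[OF involution dual_fun_gp[OF \<phi>]]) auto
  also have "dfun n r \<phi> ys = tract_sign F (ys @ xs) \<otimes> \<tau> (\<phi> xs)"
    using d' d(3) by (intro dual_fun_eq[OF involution \<phi>]) auto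
  also have "\<tau> (tract_sign F (ys @ xs) \<otimes> \<tau> (\<phi> xs)) = tract_sign F (ys @ xs) \<otimes> \<phi> xs"
    using gp_function_carrier[OF \<phi>] by (simp add: \<tau>_mult \<tau>_sign \<tau>_\<tau> \<tau>_carrier sign_carrier)
  also have "tract_sign F (ys @ xs) = tract_eps F [^] (r * (n - r)) \<otimes> tract_sign F (xs @ ys)"
    using sign_rotate[of xs ys] d ly len by simp
  also have "tract_sign F (xs @ ys) \<otimes> (tract_eps F [^] (r * (n - r)) \<otimes> tract_sign F (xs @ ys) \<otimes> \<phi> xs)
      = (tract_sign F (xs @ ys) \<otimes> tract_sign F (xs @ ys)) \<otimes> (tract_eps F [^] (r * (n - r)) \<otimes> \<phi> xs)"
    using gp_function_carrier[OF \<phi>] sign_carrier eps_pow_carrier by (simp add: m_ac)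
  also have "tract_sign F (xs @ ys) \<otimes> tract_sign F (xs @ ys) = \<one>"
    using eps_eps by (simp add: tract_sign_def)
  finally show ?thesis using gp_function_carrier[OF \<phi>] eps_pow_carrier by simp
qed

text \<open>The union in \<open>dual\<close> collapses: replacing \<open>\<phi>\<close> by
  \<open>c \<phi>\<close> multiplies its dual by the unit \<open>\<tau> c\<close>, so all
  representatives yield the same class.\<close>

lemma dual_gp_class:
  assumes \<phi>: "gp_function F n r \<phi>"
  shows "dual F \<tau> n (gp_class F \<phi>) = gp_class F (dfun n r \<phi>)"
proof -
  note carr = gp_function_carrier[OF \<phi>]
  have rk: "rk F n (gp_class F \<phi>) = r" using \<phi> by (auto intro!: rk_eq simp: matroid_of_rank_def)
  have "gp_class F (dfun n r \<psi>) = gp_class F (dfun n r \<phi>)" if \<psi>: "\<psi> \<in> gp_class F \<phi>" for \<psi>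
  proof -
    obtain c where c: "c \<in> tract_units F" "\<psi> = (\<lambda>xs. c \<otimes> \<phi> xs)"
      using \<psi> unfolding gp_class_def by blast
    have "dfun n r \<psi> = (\<lambda>xs. \<tau> c \<otimes> dfun n r \<phi> xs)"
      using dual_fun_scale[of _ \<phi>, OF unit_carrier[OF c(1)] carr] c(2) by auto
    then show ?thesis using gp_class_scale[of _ "dfun n r \<phi>", OF \<tau>_unit[OF c(1)] dual_fun_carrier[of \<phi>, OF carr]] by simp
  qed
  then show ?thesis using self_in_gp_class[of \<phi>, OF carr] unfolding dual_def rk by blast
qed

lemma dual_matroid:
  assumes "matroid_of_rank F n r M"
  shows "matroid_of_rank F n (n - r) (dual F \<tau> n M)"
  using assms dual_gp_class dual_fun_gp unfolding matroid_of_rank_def by blast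

text \<open>The factor relating \<open>\<phi>\<close> to its double dual is a power of
  \<open>\<epsilon>\<close>, hence a unit, and disappears in the class.\<close>

lemma dual_dual:
  assumes "tract_matroid F n M"
  shows "dual F \<tau> n (dual F \<tau> n M) = M"
proof -
  obtain r \<phi> where \<phi>: "gp_function F n r \<phi>" "M = gp_class F \<phi>"
    using assms by (auto simp: tract_matroid_def matroid_of_rank_def)
  have "dfun n (n - r) (dfun n r \<phi>) = (\<lambda>xs. tract_eps F [^] (r * (n - r)) \<otimes> \<phi> xs)"
    using dual_fun_dual_fun[OF \<phi>(1)] by auto
  then show ?thesis
    using \<phi> dual_gp_class[OF \<phi>(1)] dual_gp_class[OF dual_fun_gp[OF \<phi>(1)]]
      gp_class_scale[of _ \<phi>, OF eps_pow_unit gp_function_carrier[OF \<phi>(1)]] by simp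
qed

lemma dual_quotient:
  assumes "tract_matroid F n N" "tract_matroid F n M" "tract_quotient F n N M"
  shows "tract_quotient F n (dual F \<tau> n M) (dual F \<tau> n N)"
proof -
  obtain w \<nu> where \<nu>: "gp_function F n w \<nu>" "N = gp_class F \<nu>"
    using assms(1) by (auto simp: tract_matroid_def matroid_of_rank_def)
  obtain r \<mu> where \<mu>: "gp_function F n r \<mu>" "M = gp_class F \<mu>"
    using assms(2) by (auto simp: tract_matroid_def matroid_of_rank_def)
  have "pluecker_rel F n w \<nu> r \<mu>" using assms(3) tract_quotient_iff[OF \<nu>(1) \<mu>(1)] \<nu>(2) \<mu>(2) by simp
  from pluecker_rel_dual[OF \<nu>(1) \<mu>(1) this] show ?thesis
    using tract_quotient_iff[OF dual_fun_gp[OF \<mu>(1)] dual_fun_gp[OF \<nu>(1)]]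
      dual_gp_class[OF \<nu>(1)] dual_gp_class[OF \<mu>(1)] \<nu>(2) \<mu>(2) by simp
qed

section \<open>Duality on flags\<close>

text \<open>Duality reverses the direction of quotients and \<open>rev\<close> reverses positions,
  so the two effects compensate.\<close>

lemma dual_flag:
  assumes "Ms \<in> flag_matroids_of_rank F n rs"
  shows "rev (map (dual F \<tau> n) Ms) \<in> flag_matroids_of_rank F n (rev (map (\<lambda>r. n - r) rs))"
proof -
  have m: "\<And>M. M \<in> set Ms \<Longrightarrow> tract_matroid F n M"
    and q: "\<And>i j. i < j \<Longrightarrow> j < length Ms \<Longrightarrow> tract_quotient F n (Ms ! j) (Ms ! i)"
    and rs: "rs = map (rk F n) Ms"
    using assms by (auto simp: flag_matroids_of_rank_def flag_matroid_def)
  have d: "tract_matroid F n (dual F \<tau> n M)" "rk F n (dual F \<tau> n M) = n - rk F n M"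
    if M: "M \<in> set Ms" for M
  proof -
    obtain r where "matroid_of_rank F n r M" using m[OF M] by (auto simp: tract_matroid_def)
    from dual_matroid[OF this] rk_eq[OF this] rk_eq[OF dual_matroid[OF this]]
    show "tract_matroid F n (dual F \<tau> n M)" "rk F n (dual F \<tau> n M) = n - rk F n M"
      by (auto simp: tract_matroid_def)
  qed
  have "tract_quotient F n (rev (map (dual F \<tau> n) Ms) ! j) (rev (map (dual F \<tau> n) Ms) ! i)"
    if "i < j" "j < length Ms" for i j
    using that m by (auto simp: rev_nth intro!: dual_quotient q)
  then show ?thesis
    using d by (auto simp: flag_matroids_of_rank_def flag_matroid_def rs rev_map)
qed

end

theorem theorem2p12:
  fixes F :: "('a, 'b) tract_scheme" and \<tau> :: "'a \<Rightarrow> 'a" and n :: nat and rs :: "nat list"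
  assumes "tract F" and "tract_involution F \<tau>"
    and "sorted rs" and "\<forall>r\<in>set rs. r \<le> n"
  shows "bij_betw (\<lambda>Ms. rev (map (dual F \<tau> n) Ms))
           (flag_matroids_of_rank F n rs)
           (flag_matroids_of_rank F n (rev (map (\<lambda>r. n - r) rs)))"
proof -
  interpret tract F by fact
  interpret involutive_tract F \<tau> by unfold_locales fact
  let ?D = "\<lambda>Ms. rev (map (dual F \<tau> n) Ms)"
  let ?rs' = "rev (map (\<lambda>r. n - r) rs)"
  \<comment> \<open>Stated for an arbitrary rank sequence \<open>qs\<close>, so that it serves both
    for the domain and for the codomain.\<close>
  have inv: "?D (?D Ms) = Ms" if "Ms \<in> flag_matroids_of_rank F n qs" for Ms qs
    using that dual_dual
    by (auto simp: flag_matroids_of_rank_def flag_matroid_def rev_map intro!: map_idI)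
  \<comment> \<open>The bound \<open>r \<le> n\<close> enters here: with truncating subtraction it
    gives \<open>n - (n - r) = r\<close>.\<close>
  have rs: "rev (map (\<lambda>r. n - r) ?rs') = rs"
    using assms(4) by (auto simp: rev_map intro!: map_idI)
  show ?thesis
  proof (rule bij_betw_byWitness[where f' = ?D])
    show "?D ` flag_matroids_of_rank F n ?rs' \<subseteq> flag_matroids_of_rank F n rs"
      using dual_flag[of _ n ?rs'] unfolding rs by blast
  qed (use inv dual_flag in blast)+
qed

end
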